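(* Let $k\in\mathbb N^+$ and let $H$ be a nontrivial $k$-monoid. Then $r=\mathrm{ind}\,H$ if and only if there exists $B\subseteq\beta(H)$ such that (1) $|B|=r$; (2) $\langle B\rangle$ is free; and (3) for any $h\in\beta(H)\setminus B$ there exist $c\in\mathbb N^+$ and $f,g\in\langle B\rangle$ such that $f+ch=g$.
   Context: $\mathbb N=\{0,1,2,\ldots\}$, $\mathbb N^+=\mathbb N\setminus\{0\}$. A $k$-monoid is a submonoid of $(\mathbb N^k,+)$, with zero element $0_k$; it is nontrivial if it is not $\{0_k\}$. An isomorphism between a $k$-monoid and an $l$-monoid is a bijective additive map; $\cong$ denotes isomorphism. $\mathrm{ind}\,H=\min\{r\in\mathbb N^+: H\cong K\text{ for some }r\text{-monoid }K\}$. With $H^*=H\setminus\{0_k\}$, $\beta(H)=H^*\setminus(H^*+H^* )$ is the unique minimal generating set of $H$. $\langle B\rangle$ is the submonoid of $\mathbb N^k$ generated by $B$. A $k$-monoid $F$ is free if every element of $F$ is uniquely a finite $\mathbb N$-linear combination of elements of $\beta(F)$ (i.e. $F$ is a free commutative monoid). *)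

theory Defs
  imports "HOL.Hull" "HOL-Library.Function_Algebras" "HOL-Library.Set_Algebras"
begin

text \<open>
  The dimension \<open>k\<close> varies inside the statement (it is minimised over in \<open>ind\<close>), so a vector in
  \<open>\<nat>\<^sup>k\<close> is a function \<open>nat \<Rightarrow> nat\<close> vanishing outside \<open>{..<k}\<close>. Addition and zero are
  the pointwise ones of \<open>HOL-Library.Function_Algebras\<close>.
\<close>

type_synonym nvec = "nat \<Rightarrow> nat"

definition nat_space :: "nat \<Rightarrow> nvec set" where
  "nat_space k = {x. \<forall>i\<ge>k. x i = 0}"

definition nscale :: "nat \<Rightarrow> nvec \<Rightarrow> nvec" (infixr "\<cdot>" 75) where
  "c \<cdot> x = (\<lambda>i. c * x i)"

definition kmonoid :: "nat \<Rightarrow> nvec set \<Rightarrow> bool" where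
  "kmonoid k H \<longleftrightarrow> H \<subseteq> nat_space k \<and> 0 \<in> H \<and> (\<forall>x\<in>H. \<forall>y\<in>H. x + y \<in> H)"

definition monoid_isomorphic :: "nvec set \<Rightarrow> nvec set \<Rightarrow> bool" (infix "\<cong>" 50) where
  "H \<cong> K \<longleftrightarrow>
     (\<exists>\<phi>. bij_betw \<phi> H K \<and> (\<forall>x\<in>H. \<forall>y\<in>H. \<phi> (x + y) = \<phi> x + \<phi> y))"

text \<open>The minimum exists for every \<open>k\<close>-monoid with \<open>k > 0\<close>: \<open>r = k\<close> qualifies.\<close>

definition ind :: "nvec set \<Rightarrow> nat" where
  "ind H = (LEAST r. r > 0 \<and> (\<exists>K. kmonoid r K \<and> H \<cong> K))"

definition nonzero :: "nvec set \<Rightarrow> nvec set" where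
  "nonzero H = H - {0}"

text \<open>The sum of two sets is the Minkowski sum of \<open>HOL-Library.Set_Algebras\<close>.\<close>

definition \<beta> :: "nvec set \<Rightarrow> nvec set" where
  "\<beta> H = nonzero H - (nonzero H + nonzero H)"

definition generated :: "nat \<Rightarrow> nvec set \<Rightarrow> nvec set" where
  "generated k B = kmonoid k hull B"

text \<open>
  The coefficient family \<open>c\<close> of a linear combination is a finitely supported function
  vanishing outside \<open>\<beta> F\<close>, so that uniqueness of \<open>c\<close> is uniqueness of the coefficients.
\<close>

definition free_kmonoid :: "nvec set \<Rightarrow> bool" where
  "free_kmonoid F \<longleftrightarrow>
     (\<forall>x\<in>F. \<exists>!c :: nvec \<Rightarrow> nat.
        finite {b. c b \<noteq> 0} \<and> {b. c b \<noteq> 0} \<subseteq> \<beta> F \<and> x = (\<Sum>b | c b \<noteq> 0. c b \<cdot> b))"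

end

theory Submission
  imports Defs Complex_Main
begin

text \<open>
  Embed \<open>\<nat>\<^sup>k\<close> into a rational vector space. The statement then says that the index of a
  nontrivial \<open>k\<close>-monoid \<open>H\<close> is its rank, the dimension of its rational span: the sets \<open>B\<close> of
  atoms such that \<open>\<langle>B\<rangle>\<close> is free and every other atom \<open>h\<close> satisfies a relation \<open>f + c h = g\<close>
  over \<open>\<langle>B\<rangle>\<close> are exactly the bases of this span that consist of atoms.

  The reason is that a linear relation over the rationals becomes, after clearing denominators and
  moving negative terms to the other side, an equality of two natural combinations. An atom of \<open>H\<close>
  remains an atom in every submonoid that contains it, so \<open>B\<close> is the set of atoms of \<open>\<langle>B\<rangle>\<close>, and
  freeness of \<open>\<langle>B\<rangle>\<close> is linear independence of \<open>B\<close> (\<open>free_generated_iff_independent\<close>). Likewise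
  the relation \<open>f + c h = g\<close> says that \<open>h\<close> lies in the span of \<open>B\<close>
  (\<open>cancellative_relation_iff_in_span\<close>). As \<open>H\<close> is generated by its atoms
  (\<open>kmonoid_subset_span_atoms\<close>), a maximal independent set of atoms is such a basis
  (\<open>exists_basis_of_atoms\<close>).

  That the index equals the rank (\<open>ind_eq_card_basis\<close>) has two parts. An equality of natural
  combinations is preserved and reflected by isomorphisms, so a copy of \<open>H\<close> in \<open>\<nat>\<^sup>r\<close> contains
  \<open>|B|\<close> independent vectors, whence \<open>|B| \<le> r\<close> (\<open>card_independent_le_dimension\<close>). Conversely, write the
  elements of a basis \<open>B\<close> as the rows of a matrix. A maximal independent set of its columns has at
  most \<open>|B|\<close> members, and the other columns are combinations of these. Hence the corresponding
  coordinates of an element of \<open>H\<close> are determined by the remaining ones, and forgetting them embeds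
  \<open>H\<close> into a space of dimension \<open>|B|\<close> (\<open>exists_isomorphic_of_dimension_card\<close>).
\<close>

section \<open>The rational vector space of functions\<close>

definition rscale :: "rat \<Rightarrow> ('a \<Rightarrow> rat) \<Rightarrow> 'a \<Rightarrow> rat" where
  "rscale c x = (\<lambda>i. c * x i)"

lemma rscale_apply [simp]: "rscale c x i = c * x i"
  by (simp add: rscale_def)

global_interpretation ratfun: vector_space rscale
  by standard (simp_all add: fun_eq_iff algebra_simps)

lemma sum_fun_apply [simp]: "(\<Sum>b\<in>B. F b) i = (\<Sum>b\<in>B. F b i)"
  by (induction B rule: infinite_finite_induct) simp_all

lemma finite_independent_bound:
  fixes S :: "('a \<Rightarrow> rat) set"
  assumes A: "finite A" and S: "ratfun.independent S"
    and supp: "\<And>f i. f \<in> S \<Longrightarrow> i \<notin> A \<Longrightarrow> f i = 0"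
  shows "finite S \<and> card S \<le> card A"
proof -
  define e :: "'a \<Rightarrow> 'a \<Rightarrow> rat" where "e a = (\<lambda>i. if i = a then 1 else 0)" for a
  have "f \<in> ratfun.span (e ` A)" if "f \<in> S" for f
  proof -
    have "f = (\<Sum>a\<in>A. rscale (f a) (e a))"
    proof
      fix i
      have "(\<Sum>a\<in>A. f a * e a i) = (\<Sum>a\<in>A. if a = i then f a else 0)"
        by (rule sum.cong) (auto simp: e_def)
      also have "\<dots> = f i"
        using supp[OF that, of i] A by simp
      finally show "f i = (\<Sum>a\<in>A. rscale (f a) (e a)) i"
        by simp
    qed
    moreover have "(\<Sum>a\<in>A. rscale (f a) (e a)) \<in> ratfun.span (e ` A)"
      by (intro ratfun.span_sum ratfun.span_scale ratfun.span_base) auto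
    ultimately show ?thesis
      by simp
  qed
  then have "finite S \<and> card S \<le> card (e ` A)"
    using ratfun.independent_span_bound[of "e ` A" S] A S by auto
  then show ?thesis
    using card_image_le[OF A, of e] by linarith
qed

lemma clear_denominators:
  fixes q :: "'b \<Rightarrow> rat"
  assumes "finite B"
  shows "\<exists>c>0. \<exists>f g :: 'b \<Rightarrow> nat. \<forall>b\<in>B. of_nat c * q b = of_nat (f b) - of_nat (g b)"
proof -
  have "\<exists>c::nat. c > 0 \<and> (\<forall>b\<in>B. of_nat c * q b \<in> \<int>)"
    using assms
  proof induction
    case empty
    show ?case by (rule exI[of _ 1]) simp
  next
    case (insert a B)
    then obtain c :: nat where c: "c > 0" "\<forall>b\<in>B. of_nat c * q b \<in> \<int>"
      by blast
    obtain m n where qa: "quotient_of (q a) = (m, n)"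
      by fastforce
    define d where "d = nat n"
    have d: "d > 0" and "q a = of_int m / of_nat d"
      using quotient_of_div[OF qa] quotient_of_denom_pos[OF qa] by (simp_all add: d_def)
    then have "of_nat (c * d) * q a = of_int (int c * m)"
      by simp
    then have "of_nat (c * d) * q a \<in> \<int>"
      by (simp only: Ints_of_int)
    moreover have "of_nat (c * d) * q b \<in> \<int>" if "b \<in> B" for b
    proof -
      have "of_nat (c * d) * q b = of_nat d * (of_nat c * q b)"
        by (simp add: mult_ac)
      then show ?thesis
        using c(2) that by (simp only: Ints_mult Ints_of_nat)
    qed
    ultimately have "\<forall>b\<in>insert a B. of_nat (c * d) * q b \<in> \<int>"
      by blast
    moreover have "c * d > 0"
      using c(1) d by simp
    ultimately show ?case
      by blast
  qed
  then obtain c :: nat where c: "c > 0" "\<forall>b\<in>B. of_nat c * q b \<in> \<int>"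
    by blast
  then have "\<forall>b\<in>B. \<exists>m. of_nat c * q b = of_int m"
    by (auto elim: Ints_cases)
  then obtain z where z: "\<forall>b\<in>B. of_nat c * q b = of_int (z b)"
    by metis
  define f g where "f b = nat (z b)" and "g b = nat (- z b)" for b
  have "\<forall>b\<in>B. of_nat c * q b = of_nat (f b) - of_nat (g b)"
    using z by (auto simp: f_def g_def)
  then show ?thesis
    using c(1) by (intro exI conjI)
qed

section \<open>Natural vectors and linear independence\<close>

definition emb :: "nvec \<Rightarrow> nat \<Rightarrow> rat" where
  "emb x = (\<lambda>i. of_nat (x i))"

lemma emb_apply [simp]: "emb x i = of_nat (x i)"
  by (simp add: emb_def)

lemma inj_emb: "inj emb"
  by (auto simp: inj_def fun_eq_iff)

lemma emb_eq_iff [simp]: "emb x = emb y \<longleftrightarrow> x = y"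
  using inj_emb by (auto simp: inj_def)

lemma emb_add: "emb (x + y) = emb x + emb y"
  by (simp add: fun_eq_iff)

lemma emb_zero: "emb 0 = 0"
  by (simp add: fun_eq_iff)

lemma nscale_apply [simp]: "(c \<cdot> x) i = c * x i"
  by (simp add: nscale_def)

lemma nscale_zero: "0 \<cdot> x = 0"
  by (simp add: fun_eq_iff)

lemma nscale_Suc: "Suc n \<cdot> x = x + n \<cdot> x"
  by (simp add: fun_eq_iff)

lemma emb_nscale: "emb (c \<cdot> x) = rscale (of_nat c) (emb x)"
  by (simp add: fun_eq_iff)

lemma emb_sum: "emb (\<Sum>b\<in>B. f b \<cdot> b) = (\<Sum>b\<in>B. rscale (of_nat (f b)) (emb b))"
  by (simp add: fun_eq_iff)

lemma span_emb_image:
  assumes "finite B"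
  shows "v \<in> ratfun.span (emb ` B) \<longleftrightarrow> (\<exists>q. v = (\<Sum>b\<in>B. rscale (q b) (emb b)))"
proof
  assume "v \<in> ratfun.span (emb ` B)"
  then obtain u where "v = (\<Sum>w\<in>emb ` B. rscale (u w) w)"
    using ratfun.span_finite[of "emb ` B"] assms by auto
  also have "\<dots> = (\<Sum>b\<in>B. rscale (u (emb b)) (emb b))"
    by (subst sum.reindex) (auto intro: inj_on_subset[OF inj_emb])
  finally show "\<exists>q. v = (\<Sum>b\<in>B. rscale (q b) (emb b))"
    by (rule exI[of _ "\<lambda>b. u (emb b)"])
next
  assume "\<exists>q. v = (\<Sum>b\<in>B. rscale (q b) (emb b))"
  then obtain q where q: "v = (\<Sum>b\<in>B. rscale (q b) (emb b))"
    by blast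
  show "v \<in> ratfun.span (emb ` B)"
    unfolding q by (intro ratfun.span_sum ratfun.span_scale ratfun.span_base) auto
qed

text \<open>
  Independence in a form that refers only to the additive structure, so that it can be transported
  along isomorphisms of monoids.
\<close>

definition nat_independent :: "nvec set \<Rightarrow> bool" where
  "nat_independent B \<longleftrightarrow>
     (\<forall>f g. (\<Sum>b\<in>B. f b \<cdot> b) = (\<Sum>b\<in>B. g b \<cdot> b) \<longrightarrow> (\<forall>b\<in>B. f b = g b))"

lemma nat_independentD:
  assumes "nat_independent B" "(\<Sum>b\<in>B. f b \<cdot> b) = (\<Sum>b\<in>B. g b \<cdot> b)"
  shows "\<forall>b\<in>B. f b = g b"
  by (rule mp[OF spec[OF spec[OF assms(1)[unfolded nat_independent_def]]] assms(2)])

text \<open>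
  Two natural combinations with coefficients \<open>f\<close> and \<open>g\<close> coincide if and only if the rational
  combination with coefficients \<open>f - g\<close> vanishes, and up to a positive factor every rational
  coefficient family is such a difference.
\<close>

lemma nat_independent_iff:
  assumes "finite B"
  shows "nat_independent B \<longleftrightarrow> ratfun.independent (emb ` B)"
proof
  assume ind: "nat_independent B"
  show "ratfun.independent (emb ` B)"
  proof
    assume "ratfun.dependent (emb ` B)"
    then obtain u v where v: "v \<in> emb ` B" "u v \<noteq> 0"
      and "(\<Sum>w\<in>emb ` B. rscale (u w) w) = 0"
      using ratfun.dependent_finite[of "emb ` B"] assms by auto
    then have 0: "(\<Sum>b\<in>B. rscale (u (emb b)) (emb b)) = 0"
      by (subst (asm) sum.reindex) (auto intro: inj_on_subset[OF inj_emb])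
    obtain c :: nat and f g where c: "c > 0"
      and fg: "\<forall>b\<in>B. of_nat c * u (emb b) = of_nat (f b) - of_nat (g b)"
      using clear_denominators[OF assms, of "\<lambda>b. u (emb b)"] by blast
    have "emb (\<Sum>b\<in>B. f b \<cdot> b) - emb (\<Sum>b\<in>B. g b \<cdot> b)
        = (\<Sum>b\<in>B. rscale (of_nat (f b) - of_nat (g b)) (emb b))"
      by (simp add: emb_sum ratfun.scale_left_diff_distrib sum_subtractf)
    also have "\<dots> = (\<Sum>b\<in>B. rscale (of_nat c) (rscale (u (emb b)) (emb b)))"
      by (rule sum.cong) (simp_all add: fg[rule_format, symmetric])
    also have "\<dots> = 0"
      by (simp only: ratfun.scale_sum_right[symmetric] 0 ratfun.scale_zero_right)
    finally have "(\<Sum>b\<in>B. f b \<cdot> b) = (\<Sum>b\<in>B. g b \<cdot> b)"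
      by simp
    then have "\<forall>b\<in>B. f b = g b"
      by (rule nat_independentD[OF ind])
    then show False
      using v fg c by auto
  qed
next
  assume ind: "ratfun.independent (emb ` B)"
  show "nat_independent B"
    unfolding nat_independent_def
  proof (intro allI impI)
    fix f g :: "nvec \<Rightarrow> nat"
    assume eq: "(\<Sum>b\<in>B. f b \<cdot> b) = (\<Sum>b\<in>B. g b \<cdot> b)"
    define u :: "(nat \<Rightarrow> rat) \<Rightarrow> rat"
      where "u w = of_nat (f (inv emb w)) - of_nat (g (inv emb w))" for w
    have u: "u (emb b) = of_nat (f b) - of_nat (g b)" for b
      by (simp add: u_def inv_f_f[OF inj_emb])
    have "(\<Sum>w\<in>emb ` B. rscale (u w) w) = (\<Sum>b\<in>B. rscale (u (emb b)) (emb b))"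
      by (subst sum.reindex) (auto intro: inj_on_subset[OF inj_emb])
    also have "\<dots> = emb (\<Sum>b\<in>B. f b \<cdot> b) - emb (\<Sum>b\<in>B. g b \<cdot> b)"
      by (simp add: emb_sum u ratfun.scale_left_diff_distrib sum_subtractf)
    finally have "\<forall>w\<in>emb ` B. u w = 0"
      using ind ratfun.dependent_finite[of "emb ` B"] assms eq by auto
    then show "\<forall>b\<in>B. f b = g b"
      by (simp add: u)
  qed
qed

section \<open>Generated submonoids and atoms\<close>

lemma kmonoid_sum:
  assumes "kmonoid k H" "\<And>b. b \<in> B \<Longrightarrow> F b \<in> H"
  shows "(\<Sum>b\<in>B. F b) \<in> H"
proof -
  have zero: "0 \<in> H" and add: "\<And>x y. x \<in> H \<Longrightarrow> y \<in> H \<Longrightarrow> x + y \<in> H"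
    using assms(1) unfolding kmonoid_def by blast+
  show ?thesis
    using assms(2) by (induction B rule: infinite_finite_induct) (simp_all add: zero add)
qed

lemma kmonoid_nscale:
  assumes "kmonoid k H" "x \<in> H"
  shows "c \<cdot> x \<in> H"
proof -
  have zero: "0 \<in> H" and add: "\<And>y. y \<in> H \<Longrightarrow> x + y \<in> H"
    using assms unfolding kmonoid_def by blast+
  show ?thesis
    by (induction c) (simp_all only: nscale_zero nscale_Suc zero add)
qed

lemma generated_eq:
  assumes B: "finite B" "B \<subseteq> nat_space k"
  shows "generated k B = range (\<lambda>f. \<Sum>b\<in>B. f b \<cdot> b)" (is "_ = range ?comb")
proof -
  have "b \<in> range ?comb" if "b \<in> B" for b
  proof (rule range_eqI[where x = "\<lambda>a. if a = b then 1 else 0"])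
    have "(\<Sum>a\<in>B. (if a = b then 1 else 0) \<cdot> a) = (\<Sum>a\<in>B. if a = b then a else 0)"
      by (rule sum.cong) (auto simp: nscale_def)
    then show "b = (\<Sum>a\<in>B. (if a = b then 1 else 0) \<cdot> a)"
      using that B by simp
  qed
  then have gens: "B \<subseteq> range ?comb"
    by (rule subsetI)
  have closed: "kmonoid k (range ?comb)"
    unfolding kmonoid_def
  proof (intro conjI ballI)
    have "?comb f i = 0" if "i \<ge> k" for f i
    proof -
      have "\<forall>b\<in>B. b i = 0"
        using B(2) that by (auto simp: nat_space_def)
      then show ?thesis
        using B(1) by simp
    qed
    then show "range ?comb \<subseteq> nat_space k"
      unfolding nat_space_def by (intro image_subsetI CollectI allI impI)
    show "0 \<in> range ?comb"
      by (rule range_eqI[where x = "\<lambda>b. 0"]) (simp only: nscale_zero sum.neutral_const)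
  next
    fix x y assume "x \<in> range ?comb" "y \<in> range ?comb"
    then obtain f g where fg: "x = ?comb f" "y = ?comb g"
      by (elim rangeE)
    show "x + y \<in> range ?comb"
      by (rule range_eqI[where x = "\<lambda>b. f b + g b"])
        (rule ext, simp add: fg sum.distrib add_mult_distrib)
  qed
  have least: "range ?comb \<subseteq> M" if M: "B \<subseteq> M" "kmonoid k M" for M
  proof (rule image_subsetI)
    fix f :: "nvec \<Rightarrow> nat"
    show "?comb f \<in> M"
      using M(1) by (intro kmonoid_sum[OF M(2)] kmonoid_nscale[OF M(2)]) (rule subsetD)
  qed
  show ?thesis
    unfolding generated_def by (rule hull_unique[where S = "kmonoid k", OF gens closed least])
qed

lemma combination_in_generated:
  assumes "finite B" "B \<subseteq> nat_space k"
  shows "(\<Sum>b\<in>B. f b \<cdot> b) \<in> generated k B"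
  unfolding generated_eq[OF assms] by (rule rangeI)

lemma atom_subset: "\<beta> H \<subseteq> H" "0 \<notin> \<beta> H"
  by (auto simp: \<beta>_def nonzero_def)

lemma atoms_subset_nat_space: "kmonoid k H \<Longrightarrow> B \<subseteq> \<beta> H \<Longrightarrow> B \<subseteq> nat_space k"
  using atom_subset(1) unfolding kmonoid_def by blast

text \<open>
  An atom of \<open>H\<close> cannot split in the smaller monoid, and in a combination that involves at least
  one generator and is not itself a generator, one generator can be split off.
\<close>

lemma atoms_generated:
  assumes H: "kmonoid k H" and B: "finite B" "B \<subseteq> \<beta> H"
  shows "\<beta> (generated k B) = B"
proof
  have BH: "B \<subseteq> H" "0 \<notin> B"
    using B atom_subset by auto
  have Bk: "B \<subseteq> nat_space k"
    using atoms_subset_nat_space[OF H B(2)] .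
  have gen_H: "generated k B \<subseteq> H"
    unfolding generated_def using H BH by (simp add: hull_minimal)
  have B_gen: "B \<subseteq> generated k B"
    unfolding generated_def by (rule hull_subset)
  show "B \<subseteq> \<beta> (generated k B)"
  proof
    fix b assume "b \<in> B"
    then have "b \<in> \<beta> H" "b \<in> generated k B" "b \<noteq> 0"
      using B B_gen BH by auto
    moreover have "nonzero (generated k B) + nonzero (generated k B) \<subseteq> nonzero H + nonzero H"
      using gen_H by (intro set_plus_mono2) (auto simp: nonzero_def)
    ultimately show "b \<in> \<beta> (generated k B)"
      unfolding \<beta>_def by (auto simp: nonzero_def)
  qed
  show "\<beta> (generated k B) \<subseteq> B"
  proof
    fix x assume x: "x \<in> \<beta> (generated k B)"
    then have "x \<in> generated k B" "x \<noteq> 0"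
      using atom_subset by auto
    then obtain f where f: "x = (\<Sum>b\<in>B. f b \<cdot> b)"
      using generated_eq[OF B(1) Bk] by auto
    have "\<exists>a\<in>B. f a \<noteq> 0"
    proof (rule ccontr)
      assume "\<not> ?thesis"
      then have "x = 0"
        unfolding f by (simp add: fun_eq_iff)
      with \<open>x \<noteq> 0\<close> show False ..
    qed
    then obtain a where a: "a \<in> B" "f a \<noteq> 0"
      by blast
    define y where "y = (\<Sum>b\<in>B. (if b = a then f b - 1 else f b) \<cdot> b)"
    have "(\<Sum>b\<in>B - {a}. (if b = a then f b - 1 else f b) \<cdot> b) = (\<Sum>b\<in>B - {a}. f b \<cdot> b)"
      by (rule sum.cong) auto
    moreover have "f a \<cdot> a = a + (f a - 1) \<cdot> a"
      using a by (cases "f a") (auto simp: fun_eq_iff)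
    ultimately have xy: "x = a + y"
      unfolding f y_def using a B(1) by (simp add: sum.remove[of B a] add.assoc)
    have "y \<in> generated k B"
      unfolding y_def by (rule combination_in_generated[OF B(1) Bk])
    then have "y = 0"
      using x xy a BH B_gen unfolding \<beta>_def nonzero_def by auto
    then show "x \<in> B"
      using xy a by simp
  qed
qed

text \<open>
  Since the atoms of the generated monoid are the elements of \<open>B\<close>, freeness says that each natural
  combination of \<open>B\<close> determines its coefficients.
\<close>

lemma free_generated_iff_independent:
  assumes H: "kmonoid k H" and B: "finite B" "B \<subseteq> \<beta> H"
  shows "free_kmonoid (generated k B) \<longleftrightarrow> nat_independent B"
proof -
  have Bk: "B \<subseteq> nat_space k"
    using atoms_subset_nat_space[OF H B(2)] .
  note gen = generated_eq[OF B(1) Bk]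
  have supp: "(\<Sum>b | c b \<noteq> 0. c b \<cdot> b) = (\<Sum>b\<in>B. c b \<cdot> b)"
    if "{b. c b \<noteq> 0} \<subseteq> B" for c :: "nvec \<Rightarrow> nat"
  proof (rule sum.mono_neutral_left[OF B(1) that])
    show "\<forall>b\<in>B - {b. c b \<noteq> 0}. c b \<cdot> b = 0"
      by (simp add: nscale_zero)
  qed
  \<comment> \<open>In the definition of freeness the coefficients vanish outside the set of atoms, which makes them
    unique as functions; arbitrary coefficients have to be cut down to \<open>B\<close> first.\<close>
  define restr :: "(nvec \<Rightarrow> nat) \<Rightarrow> nvec \<Rightarrow> nat"
    where "restr f b = (if b \<in> B then f b else 0)" for f b
  have restr_supp: "{b. restr f b \<noteq> 0} \<subseteq> B" for f
    by (auto simp: restr_def)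
  have restr_sum: "(\<Sum>b\<in>B. restr f b \<cdot> b) = (\<Sum>b\<in>B. f b \<cdot> b)" for f
    by (rule sum.cong) (auto simp: restr_def)
  have free: "free_kmonoid (generated k B) \<longleftrightarrow> (\<forall>x\<in>generated k B. \<exists>!c.
      {b. c b \<noteq> 0} \<subseteq> B \<and> x = (\<Sum>b\<in>B. c b \<cdot> b))"
    unfolding free_kmonoid_def atoms_generated[OF assms]
  proof (intro ball_cong refl arg_cong[where f = Ex1] ext)
    fix x and c :: "nvec \<Rightarrow> nat"
    show "(finite {b. c b \<noteq> 0} \<and> {b. c b \<noteq> 0} \<subseteq> B \<and> x = (\<Sum>b | c b \<noteq> 0. c b \<cdot> b))
        \<longleftrightarrow> ({b. c b \<noteq> 0} \<subseteq> B \<and> x = (\<Sum>b\<in>B. c b \<cdot> b))"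
      using supp[of c] finite_subset[OF _ B(1), of "{b. c b \<noteq> 0}"] by auto
  qed
  show ?thesis
    unfolding free
  proof
    assume uniq: "\<forall>x\<in>generated k B. \<exists>!c. {b. c b \<noteq> 0} \<subseteq> B \<and> x = (\<Sum>b\<in>B. c b \<cdot> b)"
    show "nat_independent B"
      unfolding nat_independent_def
    proof (intro allI impI)
      fix f g :: "nvec \<Rightarrow> nat"
      assume eq: "(\<Sum>b\<in>B. f b \<cdot> b) = (\<Sum>b\<in>B. g b \<cdot> b)"
      define P :: "(nvec \<Rightarrow> nat) \<Rightarrow> bool"
        where "P c \<longleftrightarrow> {b. c b \<noteq> 0} \<subseteq> B \<and> (\<Sum>b\<in>B. f b \<cdot> b) = (\<Sum>b\<in>B. c b \<cdot> b)" for c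
      have "\<exists>!c. P c"
        unfolding P_def by (rule bspec[OF uniq combination_in_generated[OF B(1) Bk]])
      moreover have "P (restr f)" "P (restr g)"
        unfolding P_def by (simp_all only: restr_supp restr_sum eq simp_thms)
      ultimately have "restr f = restr g"
        by blast
      then show "\<forall>b\<in>B. f b = g b"
        by (metis restr_def)
    qed
  next
    assume ind: "nat_independent B"
    show "\<forall>x\<in>generated k B. \<exists>!c. {b. c b \<noteq> 0} \<subseteq> B \<and> x = (\<Sum>b\<in>B. c b \<cdot> b)"
    proof
      fix x assume "x \<in> generated k B"
      then obtain f where f: "x = (\<Sum>b\<in>B. f b \<cdot> b)"
        unfolding gen by (elim rangeE)
      show "\<exists>!c. {b. c b \<noteq> 0} \<subseteq> B \<and> x = (\<Sum>b\<in>B. c b \<cdot> b)"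
      proof (rule ex1I[of _ "restr f"])
        show "{b. restr f b \<noteq> 0} \<subseteq> B \<and> x = (\<Sum>b\<in>B. restr f b \<cdot> b)"
          by (simp only: restr_supp restr_sum f simp_thms)
      next
        fix c assume c: "{b. c b \<noteq> 0} \<subseteq> B \<and> x = (\<Sum>b\<in>B. c b \<cdot> b)"
        then have "(\<Sum>b\<in>B. c b \<cdot> b) = (\<Sum>b\<in>B. f b \<cdot> b)"
          using f by (simp only: simp_thms)
        then have "\<forall>b\<in>B. c b = f b"
          by (rule nat_independentD[OF ind])
        then show "c = restr f"
          using c by (auto simp: fun_eq_iff restr_def)
      qed
    qed
  qed
qed

text \<open>
  A rational combination for \<open>h\<close>, multiplied by a common denominator \<open>c\<close>, writes \<open>c h\<close> as a difference
  \<open>g - f\<close> of two natural combinations. Dividing by \<open>c\<close> leads back.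
\<close>

lemma cancellative_relation_iff_in_span:
  assumes B: "finite B" "B \<subseteq> nat_space k"
  shows "(\<exists>c>0. \<exists>f\<in>generated k B. \<exists>g\<in>generated k B. f + c \<cdot> h = g)
    \<longleftrightarrow> emb h \<in> ratfun.span (emb ` B)"
proof
  assume "\<exists>c>0. \<exists>f\<in>generated k B. \<exists>g\<in>generated k B. f + c \<cdot> h = g"
  then obtain c f g where c: "c > 0" and fg: "f \<in> generated k B" "g \<in> generated k B"
    and eq: "f + c \<cdot> h = g"
    by blast
  have gen: "emb x \<in> ratfun.span (emb ` B)" if "x \<in> generated k B" for x
    using that span_emb_image[OF B(1)] unfolding generated_eq[OF B] by (auto simp: emb_sum)
  have "emb h = rscale (1 / of_nat c) (emb g - emb f)"
    using c by (simp add: eq[symmetric] fun_eq_iff)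
  then show "emb h \<in> ratfun.span (emb ` B)"
    using gen fg by (simp add: ratfun.span_scale ratfun.span_diff)
next
  assume "emb h \<in> ratfun.span (emb ` B)"
  then obtain q where q: "emb h = (\<Sum>b\<in>B. rscale (q b) (emb b))"
    using span_emb_image[OF B(1)] by blast
  obtain c :: nat and g f where c: "c > 0"
    and fg: "\<forall>b\<in>B. of_nat c * q b = of_nat (g b) - of_nat (f b)"
    using clear_denominators[OF B(1), of q] by blast
  have "emb (c \<cdot> h) = (\<Sum>b\<in>B. rscale (of_nat c * q b) (emb b))"
    by (simp add: emb_nscale q ratfun.scale_sum_right)
  also have "\<dots> = (\<Sum>b\<in>B. rscale (of_nat (g b) - of_nat (f b)) (emb b))"
    by (rule sum.cong) (simp_all add: fg)
  also have "\<dots> = emb (\<Sum>b\<in>B. g b \<cdot> b) - emb (\<Sum>b\<in>B. f b \<cdot> b)"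
    by (simp add: emb_sum ratfun.scale_left_diff_distrib sum_subtractf)
  finally have "emb ((\<Sum>b\<in>B. f b \<cdot> b) + c \<cdot> h) = emb (\<Sum>b\<in>B. g b \<cdot> b)"
    by (simp add: emb_add)
  then have "(\<Sum>b\<in>B. f b \<cdot> b) + c \<cdot> h = (\<Sum>b\<in>B. g b \<cdot> b)"
    by simp
  then show "\<exists>c>0. \<exists>f\<in>generated k B. \<exists>g\<in>generated k B. f + c \<cdot> h = g"
    using c combination_in_generated[OF B] by (intro exI[of _ c] conjI bexI)
qed

text \<open>
  Every element is a sum of atoms, because splitting a nonzero element lowers the sum of the
  coordinates.
\<close>

lemma kmonoid_subset_span_atoms:
  assumes H: "kmonoid k H" and h: "h \<in> H"
  shows "emb h \<in> ratfun.span (emb ` \<beta> H)"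
  using h
proof (induction "\<Sum>i<k. h i" arbitrary: h rule: less_induct)
  case less
  have pos: "(\<Sum>i<k. x i) > 0" if "x \<in> H" "x \<noteq> 0" for x
  proof -
    have "\<exists>i. x i \<noteq> 0"
      using that(2) by (auto simp: fun_eq_iff)
    then obtain i where i: "x i \<noteq> 0"
      by blast
    have "x \<in> nat_space k"
      using that(1) H unfolding kmonoid_def by blast
    then have "i < k"
      using i by (metis (mono_tags, lifting) mem_Collect_eq nat_space_def not_le)
    then show ?thesis
      using i sum_pos2[of "{..<k}" i x] by simp
  qed
  consider "h = 0" | "h \<in> \<beta> H" | x y where "x \<in> nonzero H" "y \<in> nonzero H" "h = x + y"
    using less.prems unfolding \<beta>_def nonzero_def set_plus_def by blast
  then show ?case
  proof cases
    case 1
    then show ?thesis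
      by (simp add: emb_zero ratfun.span_zero)
  next
    case 2
    then show ?thesis
      by (simp add: ratfun.span_base)
  next
    case 3
    then have "x \<in> H" "y \<in> H" "(\<Sum>i<k. x i) > 0" "(\<Sum>i<k. y i) > 0"
      using pos by (auto simp: nonzero_def)
    then show ?thesis
      using less.hyps[of x] less.hyps[of y] 3
      by (simp add: emb_add sum.distrib ratfun.span_add)
  qed
qed

section \<open>The index is the rank\<close>

lemma additive_combination:
  assumes H: "kmonoid k H" and B: "B \<subseteq> H"
    and add: "\<And>x y. x \<in> H \<Longrightarrow> y \<in> H \<Longrightarrow> \<phi> (x + y) = \<phi> x + (\<phi> y :: nvec)"
  shows "\<phi> (\<Sum>b\<in>B. f b \<cdot> b) = (\<Sum>b\<in>B. f b \<cdot> \<phi> b)"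
proof -
  have 0: "\<phi> 0 = 0"
  proof -
    have "\<phi> 0 + \<phi> 0 = \<phi> 0 + 0"
      using add[of 0 0] H by (simp add: kmonoid_def)
    then show ?thesis
      by (simp only: add_left_cancel)
  qed
  have scale: "\<phi> (n \<cdot> x) = n \<cdot> \<phi> x" if "x \<in> H" for n x
  proof (induction n)
    case 0
    show ?case
      by (simp only: nscale_zero \<open>\<phi> 0 = 0\<close>)
  next
    case (Suc n)
    then show ?case
      by (simp only: nscale_Suc add[OF that kmonoid_nscale[OF H that]])
  qed
  show ?thesis
    using B
  proof (induction B rule: infinite_finite_induct)
    case (insert a B)
    then have a: "a \<in> H" and B: "B \<subseteq> H"
      by simp_all
    have "(\<Sum>b\<in>B. f b \<cdot> b) \<in> H"
      using B by (intro kmonoid_sum[OF H] kmonoid_nscale[OF H]) (rule subsetD)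
    from add[OF kmonoid_nscale[OF H a] this] show ?case
      by (simp only: sum.insert[OF insert.hyps] scale[OF a] insert.IH[OF B])
  qed (simp_all add: 0)
qed

text \<open>
  Injectivity of the isomorphism reflects equalities of natural combinations, hence the image of an
  independent set is again independent and has to fit into \<open>r\<close> dimensions.
\<close>

lemma card_independent_le_dimension:
  assumes H: "kmonoid k H" and B: "finite B" "B \<subseteq> H" "nat_independent B"
    and K: "kmonoid r K" and iso: "H \<cong> K"
  shows "card B \<le> r"
proof -
  obtain \<phi> where bij: "bij_betw \<phi> H K"
    and add: "\<And>x y. x \<in> H \<Longrightarrow> y \<in> H \<Longrightarrow> \<phi> (x + y) = \<phi> x + \<phi> y"
    using iso unfolding monoid_isomorphic_def by blast
  have inj: "inj_on \<phi> H"
    using bij by (rule bij_betw_imp_inj_on)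
  have injB: "inj_on \<phi> B"
    using inj B(2) by (rule inj_on_subset)
  have in_H: "(\<Sum>b\<in>B. f b \<cdot> b) \<in> H" for f
    using B by (intro kmonoid_sum[OF H] kmonoid_nscale[OF H]) auto
  have image: "(\<Sum>v\<in>\<phi> ` B. f v \<cdot> v) = \<phi> (\<Sum>b\<in>B. f (\<phi> b) \<cdot> b)" for f
  proof -
    have "(\<Sum>v\<in>\<phi> ` B. f v \<cdot> v) = (\<Sum>b\<in>B. f (\<phi> b) \<cdot> \<phi> b)"
      by (simp only: sum.reindex[OF injB] comp_def)
    also have "\<dots> = \<phi> (\<Sum>b\<in>B. f (\<phi> b) \<cdot> b)"
      by (rule additive_combination
          [where \<phi> = \<phi> and f = "\<lambda>b. f (\<phi> b)", OF H B(2) add, symmetric])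
    finally show ?thesis .
  qed
  have "nat_independent (\<phi> ` B)"
    unfolding nat_independent_def
  proof (intro allI impI)
    fix f g assume "(\<Sum>v\<in>\<phi> ` B. f v \<cdot> v) = (\<Sum>v\<in>\<phi> ` B. g v \<cdot> v)"
    then have "(\<Sum>b\<in>B. f (\<phi> b) \<cdot> b) = (\<Sum>b\<in>B. g (\<phi> b) \<cdot> b)"
      unfolding image by (rule inj_onD[OF inj _ in_H in_H])
    then have "\<forall>b\<in>B. f (\<phi> b) = g (\<phi> b)"
      by (rule nat_independentD[OF B(3)])
    then show "\<forall>v\<in>\<phi> ` B. f v = g v"
      by blast
  qed
  then have "ratfun.independent (emb ` \<phi> ` B)"
    using B(1) by (simp add: nat_independent_iff)
  moreover have "v i = 0" if v: "v \<in> emb ` \<phi> ` B" and i: "i \<notin> {..<r}" for v i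
  proof -
    have "\<phi> ` B \<subseteq> nat_space r"
      using B(2) bij_betw_imp_surj_on[OF bij] K unfolding kmonoid_def by blast
    then show ?thesis
      using v i by (auto simp: nat_space_def)
  qed
  ultimately have "card (emb ` \<phi> ` B) \<le> card {..<r}"
    using finite_independent_bound[of "{..<r}" "emb ` \<phi> ` B"] by blast
  moreover have "card (emb ` \<phi> ` B) = card B"
    using injB by (simp add: card_image inj_on_subset[OF inj_emb])
  ultimately show ?thesis
    by simp
qed

text \<open>
  This is the equality of row rank and column rank: the projection to the coordinates \<open>J\<close> of a
  maximal independent set of columns is injective, because the difference of two elements of \<open>H\<close>
  is a combination of the rows \<open>B\<close>, and the combination vanishes at every coordinate if it
  vanishes on \<open>J\<close>. Coordinates of elements of \<open>\<nat>\<^sup>k\<close> are nonnegative, so a projection, in contrast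
  to a general change of basis, stays inside the natural vectors.
\<close>

lemma exists_isomorphic_of_dimension_card:
  assumes H: "kmonoid k H" and B: "finite B"
    and span: "emb ` H \<subseteq> ratfun.span (emb ` B)"
  shows "\<exists>K. kmonoid (card B) K \<and> H \<cong> K"
proof -
  \<comment> \<open>The columns are set to zero outside \<open>B\<close>, so that they live in a space of dimension \<open>|B|\<close>.\<close>
  define col :: "nat \<Rightarrow> nvec \<Rightarrow> rat"
    where "col i = (\<lambda>b. if b \<in> B then of_nat (b i) else 0)" for i
  obtain C where C: "C \<subseteq> col ` {..<k}" "ratfun.independent C"
    "col ` {..<k} \<subseteq> ratfun.span C"
    using ratfun.maximal_independent_subset[of "col ` {..<k}"] by blast
  obtain J where J: "J \<subseteq> {..<k}" "inj_on col J" "C = col ` J"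
    using C(1) by (meson subset_image_inj)
  have "f b = 0" if "f \<in> C" "b \<notin> B" for f b
    using that C(1) by (auto simp: col_def)
  then have "card C \<le> card B"
    using finite_independent_bound[OF B C(2)] by blast
  then have cardJ: "card J \<le> card B"
    using J by (simp add: card_image)
  have finJ: "finite J"
    using J(1) finite_subset by blast
  obtain e where e: "bij_betw e {..<card J} J"
    using ex_bij_betw_nat_finite[OF finJ] by (auto simp: atLeast0LessThan)
  define \<pi> :: "nvec \<Rightarrow> nvec" where "\<pi> x = (\<lambda>n. if n < card J then x (e n) else 0)" for x
  have add: "\<pi> (x + y) = \<pi> x + \<pi> y" for x y
    by (simp add: \<pi>_def fun_eq_iff)
  have "inj_on \<pi> H"
  proof
    fix x y assume xy: "x \<in> H" "y \<in> H" "\<pi> x = \<pi> y"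
    have agree_J: "x j = y j" if j: "j \<in> J" for j
    proof -
      obtain n where "n < card J" "j = e n"
        using e j unfolding bij_betw_def by auto
      then show ?thesis
        using xy(3) unfolding \<pi>_def by (metis (full_types))
    qed
    have "emb x - emb y \<in> ratfun.span (emb ` B)"
      using span xy by (intro ratfun.span_diff) auto
    then obtain q where q: "emb x - emb y = (\<Sum>b\<in>B. rscale (q b) (emb b))"
      using span_emb_image[OF B] by blast
    define L :: "(nvec \<Rightarrow> rat) \<Rightarrow> rat" where "L v = (\<Sum>b\<in>B. q b * v b)" for v
    \<comment> \<open>Evaluating the combination \<open>emb x - emb y\<close> of rows at a coordinate is a linear functional of the
      corresponding column.\<close>
    have L_col: "L (col i) = of_nat (x i) - of_nat (y i)" for i
    proof -
      have "L (col i) = (\<Sum>b\<in>B. rscale (q b) (emb b)) i"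
        by (simp add: L_def col_def)
      then show ?thesis
        by (simp add: q[symmetric])
    qed
    have "ratfun.subspace {v. L v = 0}"
    proof (rule ratfun.subspaceI)
      show "0 \<in> {v. L v = 0}"
        by (simp add: L_def)
      show "v + w \<in> {v. L v = 0}" if "v \<in> {v. L v = 0}" "w \<in> {v. L v = 0}" for v w
        using that by (simp add: L_def algebra_simps sum.distrib)
      show "rscale c v \<in> {v. L v = 0}" if "v \<in> {v. L v = 0}" for c v
      proof -
        have "L (rscale c v) = c * L v"
          by (simp add: L_def sum_distrib_left mult_ac)
        then show ?thesis
          using that by simp
      qed
    qed
    moreover have "C \<subseteq> {v. L v = 0}"
      using J(3) agree_J by (auto simp: L_col)
    ultimately have "ratfun.span C \<subseteq> {v. L v = 0}"
      by (intro ratfun.span_minimal)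
    then have "L (col i) = 0" if "i < k" for i
      using C(3) that by auto
    then have "x i = y i" if "i < k" for i
      using that by (simp add: L_col)
    moreover have "x i = y i" if "\<not> i < k" for i
    proof -
      have "x \<in> nat_space k" "y \<in> nat_space k"
        using xy(1,2) H unfolding kmonoid_def by blast+
      then show ?thesis
        using that by (simp add: nat_space_def)
    qed
    ultimately show "x = y"
      by (auto simp: fun_eq_iff)
  qed
  then have "H \<cong> \<pi> ` H"
    unfolding monoid_isomorphic_def using add inj_on_imp_bij_betw by blast
  moreover have "kmonoid (card B) (\<pi> ` H)"
    unfolding kmonoid_def
  proof (intro conjI ballI)
    show "\<pi> ` H \<subseteq> nat_space (card B)"
      using cardJ by (auto simp: \<pi>_def nat_space_def)
    have "\<pi> 0 = 0"
      by (simp add: \<pi>_def fun_eq_iff)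
    then show "0 \<in> \<pi> ` H"
      using H unfolding kmonoid_def by (metis imageI)
  next
    fix u v assume "u \<in> \<pi> ` H" "v \<in> \<pi> ` H"
    then show "u + v \<in> \<pi> ` H"
      using H unfolding kmonoid_def by (auto simp: add[symmetric])
  qed
  ultimately show ?thesis
    by blast
qed

lemma ind_eq_card_basis:
  assumes H: "kmonoid k H" "H \<noteq> {0}" and B: "finite B" "B \<subseteq> H" "nat_independent B"
    and span: "emb ` H \<subseteq> ratfun.span (emb ` B)"
  shows "ind H = card B"
  unfolding ind_def
proof (rule Least_equality)
  have "B \<noteq> {}"
  proof
    assume "B = {}"
    then have "emb h = emb 0" if "h \<in> H" for h
      using span that by (auto simp: emb_zero)
    then show False
      using H by (auto simp: kmonoid_def)
  qed
  then show "card B > 0 \<and> (\<exists>K. kmonoid (card B) K \<and> H \<cong> K)"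
    using exists_isomorphic_of_dimension_card[OF H(1) B(1) span] B(1) by (simp add: card_gt_0_iff)
next
  fix r assume "r > 0 \<and> (\<exists>K. kmonoid r K \<and> H \<cong> K)"
  then show "card B \<le> r"
    using card_independent_le_dimension[OF H(1) B] by blast
qed

lemma exists_basis_of_atoms:
  assumes H: "kmonoid k H"
  shows "\<exists>B\<subseteq>\<beta> H. finite B \<and> nat_independent B \<and> emb ` \<beta> H \<subseteq> ratfun.span (emb ` B)"
proof -
  obtain C where C: "C \<subseteq> emb ` \<beta> H" "ratfun.independent C" "emb ` \<beta> H \<subseteq> ratfun.span C"
    using ratfun.maximal_independent_subset[of "emb ` \<beta> H"] by blast
  obtain B where B: "B \<subseteq> \<beta> H" "C = emb ` B"
    using C(1) by (meson subset_imageE)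
  have "v i = 0" if "v \<in> C" "i \<notin> {..<k}" for v i
    using that C(1) H atom_subset(1)[of H]
    by (auto simp: kmonoid_def nat_space_def subset_iff)
  then have "finite C"
    using finite_independent_bound[OF _ C(2), of "{..<k}"] by blast
  then have "finite B"
    unfolding B(2) by (rule finite_imageD) (rule inj_on_subset[OF inj_emb subset_UNIV])
  then show ?thesis
    using B C nat_independent_iff by blast
qed

theorem proposition2p10:
  fixes k r :: nat and H :: "nvec set"
  assumes "k > 0" and "kmonoid k H" and "H \<noteq> {0}"
  shows "r = ind H \<longleftrightarrow>
    (\<exists>B \<subseteq> \<beta> H.
       (finite B \<and> card B = r) \<and>
       free_kmonoid (generated k B) \<and>
       (\<forall>h \<in> \<beta> H - B. \<exists>c > 0. \<exists>f \<in> generated k B. \<exists>g \<in> generated k B. f + c \<cdot> h = g))"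
proof -
  note H = assms(2,3)
  have basis: "free_kmonoid (generated k B) \<and>
      (\<forall>h \<in> \<beta> H - B. \<exists>c > 0. \<exists>f \<in> generated k B. \<exists>g \<in> generated k B. f + c \<cdot> h = g)
    \<longleftrightarrow> nat_independent B \<and> emb ` \<beta> H \<subseteq> ratfun.span (emb ` B)"
    if B: "B \<subseteq> \<beta> H" "finite B" for B
  proof -
    have "B \<subseteq> nat_space k"
      using atoms_subset_nat_space[OF H(1) B(1)] .
    then have "(\<forall>h \<in> \<beta> H - B. \<exists>c > 0. \<exists>f \<in> generated k B. \<exists>g \<in> generated k B. f + c \<cdot> h = g)
      \<longleftrightarrow> (\<forall>h \<in> \<beta> H - B. emb h \<in> ratfun.span (emb ` B))"
      using cancellative_relation_iff_in_span[OF B(2)] by simp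
    also have "\<dots> \<longleftrightarrow> emb ` \<beta> H \<subseteq> ratfun.span (emb ` B)"
      using ratfun.span_superset[of "emb ` B"] by auto
    finally show ?thesis
      using free_generated_iff_independent[OF H(1) B(2,1)] by simp
  qed
  have index: "ind H = card B"
    if B: "B \<subseteq> \<beta> H" "finite B" "nat_independent B"
      and span: "emb ` \<beta> H \<subseteq> ratfun.span (emb ` B)" for B
  proof (rule ind_eq_card_basis[OF H B(2) _ B(3)])
    show "B \<subseteq> H"
      using B(1) atom_subset by blast
    show "emb ` H \<subseteq> ratfun.span (emb ` B)"
      using kmonoid_subset_span_atoms[OF H(1)]
        ratfun.span_minimal[OF span ratfun.subspace_span] by blast
  qed
  show ?thesis
    using exists_basis_of_atoms[OF H(1)] basis index by metis
qed

end
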